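(* There is no weak embedding of $\mathcal{E}$ into $\mathcal{B}^{\mathrm{eff}}$; that is, $\mathcal{E}\not\hookrightarrow\mathcal{B}^{\mathrm{eff}}$.
   Context: For pcas (partial applicative systems satisfying combinatory completeness) $\mathcal{A},\mathcal{C}$, a weak embedding is an injection $F:\mathcal{A}\to\mathcal{C}$ such that for all $a,b\in\mathcal{A}$: if $ab$ is defined in $\mathcal{A}$ then $F(a)F(b)$ is defined in $\mathcal{C}$ and equals $F(ab)$. $\mathcal{E}$ is the set of computably enumerable subsets of $\omega$ with application $X\cdot Y=\{n : \exists u\,(\langle n,u\rangle\in X\wedge D_u\subseteq Y)\}$ (the application of Scott's graph model), where $D_u$ is the finite set with canonical code $u$. $\mathcal{B}^{\mathrm{eff}}$ is the set of partial computable functions $\omega\to\omega$ with application $f\cdot g$ the partial function $n\mapsto\Phi_{f(0)}^{f\oplus g}(n)$, where $\Phi_e^Z$ is the $e$-th oracle Turing functional and an oracle computation with a partial oracle is undefined as soon as it queries a point where the oracle is undefined. *)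

theory Defs
  imports Main "HOL-Library.Nat_Bijection" "HOL-Library.FuncSet"
begin

text \<open>
  Oracle programs. The oracle computable functionals are presented by Kleene's schemes
  (zero, successor, projections, composition, primitive recursion, minimisation) relative to an
  oracle. Programs are unary; several arguments are passed through the pairing function
  \<^const>\<open>prod_encode\<close>, and the projections are its two inverses.
\<close>

datatype prog =
    Zer
  | Succ
  | Left
  | Right
  | Query
  | Tup prog prog
  | Comp prog prog
  | Rec prog prog
  | Mu prog

text \<open>
  Evaluation is strict: once the oracle is queried at a point outside its domain, the whole
  computation is undefined. Minimisation searches upwards, so every value tested before the first
  zero has to be defined.
\<close>

primrec run :: "(nat \<rightharpoonup> nat) \<Rightarrow> prog \<Rightarrow> (nat \<rightharpoonup> nat)" where
  "run Z Zer = (\<lambda>x. Some 0)"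
| "run Z Succ = (\<lambda>x. Some (Suc x))"
| "run Z Left = (\<lambda>x. Some (fst (prod_decode x)))"
| "run Z Right = (\<lambda>x. Some (snd (prod_decode x)))"
| "run Z Query = Z"
| "run Z (Tup p q) =
     (\<lambda>x. Option.bind (run Z p x) (\<lambda>y.
           Option.bind (run Z q x) (\<lambda>z. Some (prod_encode (y, z)))))"
| "run Z (Comp p q) = (\<lambda>x. Option.bind (run Z q x) (run Z p))"
| "run Z (Rec p q) =
     (\<lambda>x. case prod_decode x of (a, n) \<Rightarrow>
        rec_nat (run Z p a)
          (\<lambda>k r. Option.bind r (\<lambda>y. run Z q (prod_encode (a, prod_encode (k, y))))) n)"
| "run Z (Mu p) =
     (\<lambda>x. if \<exists>n. run Z p (prod_encode (x, n)) = Some 0 \<and>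
                (\<forall>m<n. run Z p (prod_encode (x, m)) \<noteq> None)
          then Some (LEAST n. run Z p (prod_encode (x, n)) = Some 0)
          else None)"

primrec index :: "prog \<Rightarrow> nat" where
  "index Zer = 0"
| "index Succ = 1"
| "index Left = 2"
| "index Right = 3"
| "index Query = 4"
| "index (Tup p q) = 5 + 4 * prod_encode (index p, index q)"
| "index (Comp p q) = 6 + 4 * prod_encode (index p, index q)"
| "index (Rec p q) = 7 + 4 * prod_encode (index p, index q)"
| "index (Mu p) = 8 + 4 * index p"

lemma inj_index: "inj index"
proof (rule injI)
  show "index p = index q \<Longrightarrow> p = q" for p q
  proof (induction p arbitrary: q)
    case (Tup p1 p2) then show ?case by (cases q) (auto, presburger+)
  next
    case (Comp p1 p2) then show ?case by (cases q) (auto, presburger+)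
  next
    case (Rec p1 p2) then show ?case by (cases q) (auto, presburger+)
  next
    case (Mu p) then show ?case by (cases q) (auto, presburger+)
  qed (case_tac q; simp)+
qed

lemma surj_index: "surj index"
proof -
  have "\<exists>p. index p = n" for n
  proof (induction n rule: less_induct)
    case (less n)
    show ?case
    proof (cases "n < 5")
      case True
      then have "n = 0 \<or> n = 1 \<or> n = 2 \<or> n = 3 \<or> n = 4" by linarith
      then show ?thesis by (metis index.simps(1-5))
    next
      case False
      define m where "m = (n - 5) div 4"
      obtain a b where ab: "m = prod_encode (a, b)"
        by (metis prod_decode_inverse surj_pair)
      have mn: "m < n" using False by (simp add: m_def)
      have "a < n" "b < n"
        using mn ab le_prod_encode_1[of a b] le_prod_encode_2[of b a] by simp_all
      then obtain p q r where p: "index p = a" and q: "index q = b" and r: "index r = m"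
        using less mn by metis
      have "n = 5 + 4 * m \<or> n = 6 + 4 * m \<or> n = 7 + 4 * m \<or> n = 8 + 4 * m"
        using False unfolding m_def by presburger
      then show ?thesis
        using p q r ab by (metis index.simps(6-9))
    qed
  qed
  then show ?thesis by (metis surjI)
qed

lemma bij_index: "bij index"
  using inj_index surj_index by (simp add: bij_def)

definition Phi :: "nat \<Rightarrow> (nat \<rightharpoonup> nat) \<Rightarrow> (nat \<rightharpoonup> nat)" where
  "Phi e Z = run Z (inv index e)"

text \<open>
  Relative to the nowhere defined oracle, a convergent computation makes no query at all.
\<close>

definition partial_computable :: "(nat \<rightharpoonup> nat) \<Rightarrow> bool" where
  "partial_computable f \<longleftrightarrow> (\<exists>e. f = Phi e Map.empty)"

definition comp_enum :: "nat set \<Rightarrow> bool" where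
  "comp_enum X \<longleftrightarrow> (\<exists>f. partial_computable f \<and> X = dom f)"

definition join :: "(nat \<rightharpoonup> nat) \<Rightarrow> (nat \<rightharpoonup> nat) \<Rightarrow> (nat \<rightharpoonup> nat)" (infixr "\<oplus>" 65) where
  "f \<oplus> g = (\<lambda>n. if even n then f (n div 2) else g (n div 2))"

record 'a pas =
  carrier :: "'a set"
  app :: "'a \<Rightarrow> 'a \<Rightarrow> 'a option"

definition weak_embedding :: "'a pas \<Rightarrow> 'b pas \<Rightarrow> ('a \<Rightarrow> 'b) \<Rightarrow> bool" where
  "weak_embedding A C F \<longleftrightarrow>
     F \<in> carrier A \<rightarrow> carrier C \<and> inj_on F (carrier A) \<and>
     (\<forall>a\<in>carrier A. \<forall>b\<in>carrier A. \<forall>c. app A a b = Some c \<longrightarrow> app C (F a) (F b) = Some (F c))"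

definition graph_app :: "nat set \<Rightarrow> nat set \<Rightarrow> nat set" where
  "graph_app X Y = {n. \<exists>u. prod_encode (n, u) \<in> X \<and> set_decode u \<subseteq> Y}"

definition E_pca :: "nat set pas" where
  "E_pca = \<lparr>carrier = {X. comp_enum X}, app = (\<lambda>X Y. Some (graph_app X Y))\<rparr>"

definition B_app :: "(nat \<rightharpoonup> nat) \<Rightarrow> (nat \<rightharpoonup> nat) \<Rightarrow> (nat \<rightharpoonup> nat)" where
  "B_app f g = (\<lambda>n. Option.bind (f 0) (\<lambda>e. Phi e (f \<oplus> g) n))"

text \<open>
  Application in \<open>B_eff_pca\<close> is total: its value is a partial function, possibly nowhere defined.
\<close>

definition B_eff_pca :: "(nat \<rightharpoonup> nat) pas" where
  "B_eff_pca = \<lparr>carrier = {f. partial_computable f}, app = (\<lambda>f g. Some (B_app f g))\<rparr>"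

end

theory Submission
  imports Defs
begin

text \<open>
  Let \<open>F\<close> be a weak embedding. Some \<open>S\<close> satisfies \<open>S \<cdot> {n} = {n + 1}\<close>, so \<open>F {n}\<close> is partial computable
  uniformly in \<open>n\<close>. For the halting problem \<open>K\<close> some \<open>R\<close> satisfies \<open>R \<cdot> {n} = {0}\<close> if \<open>n \<in> K\<close> and
  \<open>R \<cdot> {n} = {}\<close> otherwise. If \<open>F {}\<close> took a value at some point that \<open>F {0}\<close> does not take there, the
  values of \<open>F R \<cdot> F {n}\<close> at that point would enumerate the complement of \<open>K\<close>. Hence \<open>F {0}\<close> properly
  extends \<open>F {}\<close>, say it is defined at \<open>n\<close> and \<open>F {}\<close> is not. Now let \<open>U \<cdot> X \<cdot> Y = X \<union> Y\<close>. Then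
  \<open>F U \<cdot> f \<cdot> g\<close> is defined at \<open>n\<close> as soon as one of \<open>f\<close>, \<open>g\<close> is \<open>F {0}\<close> and the other is \<open>F {}\<close>, but
  not if both are \<open>F {}\<close>. Such a parallel disjunction is impossible for sequential oracle computations,
  which get stuck at one particular query.
\<close>

section \<open>Computable functions and decidable predicates\<close>

definition total_computable :: "(nat \<Rightarrow> nat) \<Rightarrow> bool" where
  "total_computable f \<longleftrightarrow> (\<exists>p. \<forall>x. run Map.empty p x = Some (f x))"

definition decidable :: "(nat \<Rightarrow> bool) \<Rightarrow> bool" where
  "decidable P \<longleftrightarrow> total_computable (\<lambda>x. of_bool (P x))"

lemma total_computableI: "(\<And>x. run Map.empty p x = Some (f x)) \<Longrightarrow> total_computable f"
  unfolding total_computable_def by blast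

lemma tc_id: "total_computable (\<lambda>x. x)"
  by (rule total_computableI[of "Tup Left Right"]) simp

lemma tc_comp:
  assumes "total_computable f" "total_computable g"
  shows "total_computable (\<lambda>x. f (g x))"
proof -
  obtain p q where "\<forall>x. run Map.empty p x = Some (f x)" "\<forall>x. run Map.empty q x = Some (g x)"
    using assms unfolding total_computable_def by blast
  then show ?thesis by (intro total_computableI[of "Comp p q"]) simp
qed

lemma tc_Suc: "total_computable f \<Longrightarrow> total_computable (\<lambda>x. Suc (f x))"
  by (rule tc_comp[of Suc], rule total_computableI[of Succ]) simp_all

lemma tc_fst: "total_computable f \<Longrightarrow> total_computable (\<lambda>x. fst (prod_decode (f x)))"
  by (rule tc_comp[of "\<lambda>x. fst (prod_decode x)"], rule total_computableI[of Left]) simp_all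

lemma tc_snd: "total_computable f \<Longrightarrow> total_computable (\<lambda>x. snd (prod_decode (f x)))"
  by (rule tc_comp[of "\<lambda>x. snd (prod_decode x)"], rule total_computableI[of Right]) simp_all

lemma tc_pair:
  assumes "total_computable f" "total_computable g"
  shows "total_computable (\<lambda>x. prod_encode (f x, g x))"
proof -
  obtain p q where "\<forall>x. run Map.empty p x = Some (f x)" "\<forall>x. run Map.empty q x = Some (g x)"
    using assms unfolding total_computable_def by blast
  then show ?thesis by (intro total_computableI[of "Tup p q"]) simp
qed

lemma tc_const: "total_computable (\<lambda>x. c)"
proof (induction c)
  case 0
  show ?case by (rule total_computableI[of Zer]) simp
qed (rule tc_Suc)

text \<open>The step \<open>g\<close> may use the parameter \<open>x\<close>. Its premise is stated
  for one coded argument holding parameter, counter and previous value, the format in which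
  \<open>Rec\<close> calls its step program.\<close>

lemma tc_rec_nat:
  assumes f: "total_computable f" and h: "total_computable h"
    and g: "total_computable
      (\<lambda>w. g (fst (prod_decode w)) (fst (prod_decode (snd (prod_decode w))))
             (snd (prod_decode (snd (prod_decode w)))))"
  shows "total_computable (\<lambda>x. rec_nat (f x) (g x) (h x))"
proof -
  obtain p where p: "\<And>x. run Map.empty p x = Some (f x)"
    using f unfolding total_computable_def by blast
  obtain q where q: "\<And>x. run Map.empty q x =
      Some (g (fst (prod_decode x)) (fst (prod_decode (snd (prod_decode x))))
             (snd (prod_decode (snd (prod_decode x)))))"
    using g unfolding total_computable_def by blast
  have "run Map.empty (Rec p q) (prod_encode (a, n)) = Some (rec_nat (f a) (g a) n)" for a n
    by (induction n) (simp_all add: p q)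
  then have "total_computable
      (\<lambda>w. rec_nat (f (fst (prod_decode w))) (g (fst (prod_decode w))) (snd (prod_decode w)))"
    by (intro total_computableI[of "Rec p q"]) (metis prod.collapse prod_decode_inverse)
  from tc_comp[OF this tc_pair[OF tc_id h]] show ?thesis by simp
qed

section \<open>Arithmetic by primitive recursion\<close>

lemma tc_add:
  assumes "total_computable f" "total_computable g"
  shows "total_computable (\<lambda>x. f x + g x)"
proof -
  have "total_computable (\<lambda>x. rec_nat (f x) (\<lambda>k r. Suc r) (g x))"
    by (intro tc_rec_nat assms tc_Suc tc_snd tc_id)
  moreover have "rec_nat a (\<lambda>k r. Suc r) b = a + b" for a b by (induction b) auto
  ultimately show ?thesis by simp
qed

lemma tc_mult:
  assumes "total_computable f" "total_computable g"
  shows "total_computable (\<lambda>x. f x * g x)"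
proof -
  have "total_computable (\<lambda>x. rec_nat 0 (\<lambda>k r. r + f x) (g x))"
    by (intro tc_rec_nat tc_add assms tc_snd tc_const tc_id tc_comp[OF assms(1)] tc_fst)
  moreover have "rec_nat 0 (\<lambda>k r. r + a) b = a * b" for a b :: nat by (induction b) auto
  ultimately show ?thesis by simp
qed

lemma tc_power:
  assumes "total_computable f" "total_computable g"
  shows "total_computable (\<lambda>x. f x ^ g x)"
proof -
  have "total_computable (\<lambda>x. rec_nat 1 (\<lambda>k r. f x * r) (g x))"
    by (intro tc_rec_nat tc_mult assms tc_snd tc_const tc_id tc_comp[OF assms(1)] tc_fst)
  moreover have "rec_nat 1 (\<lambda>k r. a * r) b = a ^ b" for a b :: nat by (induction b) auto
  ultimately show ?thesis by simp
qed

lemma tc_diff: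
  assumes "total_computable f" "total_computable g"
  shows "total_computable (\<lambda>x. f x - g x)"
proof -
  \<comment> \<open>Returning the counter instead of the previous value yields the predecessor;
    truncated subtraction iterates it.\<close>
  have pred: "rec_nat 0 (\<lambda>k r. k) n = n - 1" for n by (cases n) auto
  have "total_computable (\<lambda>x. rec_nat (f x) (\<lambda>k r. rec_nat 0 (\<lambda>k r. k) r) (g x))"
    by (intro tc_rec_nat assms tc_snd tc_const tc_id tc_fst)
  moreover have "rec_nat a (\<lambda>k r. rec_nat 0 (\<lambda>k r. k) r) b = a - b" for a b :: nat
    by (induction b) (auto simp: pred)
  ultimately show ?thesis by simp
qed

section \<open>Closure of decidable predicates under connectives and comparisons\<close>

lemma decidable_not:
  assumes "decidable P"
  shows "decidable (\<lambda>x. \<not> P x)"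
proof -
  have "total_computable (\<lambda>x. 1 - of_bool (P x))"
    using assms unfolding decidable_def by (intro tc_diff tc_const)
  moreover have "1 - of_bool (P x) = (of_bool (\<not> P x) :: nat)" for x by simp
  ultimately show ?thesis unfolding decidable_def by (simp only:)
qed

lemma decidable_conj: "decidable P \<Longrightarrow> decidable Q \<Longrightarrow> decidable (\<lambda>x. P x \<and> Q x)"
  unfolding decidable_def of_bool_conj by (intro tc_mult)

lemma decidable_disj: "decidable P \<Longrightarrow> decidable Q \<Longrightarrow> decidable (\<lambda>x. P x \<or> Q x)"
  using decidable_not[OF decidable_conj[OF decidable_not decidable_not], of P Q] by simp

lemma decidable_imp: "decidable P \<Longrightarrow> decidable Q \<Longrightarrow> decidable (\<lambda>x. P x \<longrightarrow> Q x)"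
  unfolding imp_conv_disj by (intro decidable_disj decidable_not)

lemma decidable_le:
  assumes "total_computable f" "total_computable g"
  shows "decidable (\<lambda>x. f x \<le> g x)"
proof -
  have "of_bool (a \<le> b) = 1 - (a - b)" for a b :: nat by (auto simp: of_bool_def)
  then show ?thesis
    unfolding decidable_def by (simp only:) (intro tc_diff tc_const assms)
qed

lemma decidable_less:
  "total_computable f \<Longrightarrow> total_computable g \<Longrightarrow> decidable (\<lambda>x. f x < g x)"
  unfolding less_eq_Suc_le by (intro decidable_le tc_Suc)

lemma decidable_eq:
  "total_computable f \<Longrightarrow> total_computable g \<Longrightarrow> decidable (\<lambda>x. f x = g x)"
  unfolding order_eq_iff by (intro decidable_le decidable_conj)

lemma decidable_comp:
  "decidable P \<Longrightarrow> total_computable f \<Longrightarrow> decidable (\<lambda>x. P (f x))"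
  unfolding decidable_def by (rule tc_comp)

section \<open>Minimisation, bounded quantifiers, division and bit tests\<close>

lemma run_Mu_total:
  assumes "\<And>n. run Z p (prod_encode (x, n)) = Some (f n)"
  shows "run Z (Mu p) x = (if \<exists>n. f n = 0 then Some (LEAST n. f n = 0) else None)"
  using assms by simp

lemma tc_Least:
  assumes P: "decidable (\<lambda>w. P (fst (prod_decode w)) (snd (prod_decode w)))"
    and ex: "\<And>x. \<exists>n. P x n"
  shows "total_computable (\<lambda>x. LEAST n. P x n)"
proof -
  obtain p where
    "\<And>w. run Map.empty p w = Some (of_bool (\<not> P (fst (prod_decode w)) (snd (prod_decode w))))"
    using decidable_not[OF P] unfolding decidable_def total_computable_def by blast
  then have "run Map.empty p (prod_encode (x, n)) = Some (of_bool (\<not> P x n))" for x n by simp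
  from run_Mu_total[OF this] show ?thesis
    using ex by (intro total_computableI[of "Mu p"]) (simp del: run.simps)
qed

lemma decidable_bex:
  assumes b: "total_computable b"
    and P: "decidable (\<lambda>w. P (fst (prod_decode w)) (snd (prod_decode w)))"
  shows "decidable (\<lambda>x. \<exists>k<b x. P x k)"
proof -
  \<comment> \<open>The disjunct \<open>n \<le> k\<close> stops the search at \<open>n\<close> at
    the latest, so it always terminates, and it stops earlier exactly if a witness exists.\<close>
  have *: "(\<exists>k<n. Q k) \<longleftrightarrow> (LEAST k. Q k \<or> n \<le> k) < n" for n :: nat and Q
  proof
    assume "\<exists>k<n. Q k"
    then obtain k where "k < n" "Q k" by blast
    then show "(LEAST k. Q k \<or> n \<le> k) < n"
      using Least_le[of "\<lambda>k. Q k \<or> n \<le> k" k] by linarith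
  next
    assume "(LEAST k. Q k \<or> n \<le> k) < n"
    moreover have "Q (LEAST k. Q k \<or> n \<le> k) \<or> n \<le> (LEAST k. Q k \<or> n \<le> k)"
      by (rule LeastI[of _ n]) simp
    ultimately show "\<exists>k<n. Q k" by auto
  qed
  have "total_computable (\<lambda>x. LEAST k. P x k \<or> b x \<le> k)"
    by (rule tc_Least) (auto intro!: decidable_disj decidable_le P tc_snd tc_id tc_comp[OF b] tc_fst)
  then show ?thesis unfolding * by (intro decidable_less b)
qed

lemma decidable_ball:
  assumes "total_computable b"
    and "decidable (\<lambda>w. P (fst (prod_decode w)) (snd (prod_decode w)))"
  shows "decidable (\<lambda>x. \<forall>k<b x. P x k)"
  using decidable_not[OF decidable_bex[OF assms(1) decidable_not[OF assms(2)]]] by simp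

text \<open>A divisor of the form \<open>Suc d\<close> cannot be zero, so the search for the
  quotient terminates.\<close>

lemma tc_div:
  assumes f: "total_computable f"
  shows "total_computable (\<lambda>x. f x div Suc d)"
proof -
  have "a div Suc d = (LEAST q. a < Suc d * Suc q)" for a
  proof (rule sym, rule Least_equality)
    show "a < Suc d * Suc (a div Suc d)" by (metis dividend_less_times_div mult_Suc_right zero_less_Suc)
    show "a div Suc d \<le> q" if "a < Suc d * Suc q" for q
      using less_mult_imp_div_less[of a "Suc q" "Suc d"] that
      by (simp add: mult.commute less_Suc_eq_le del: mult_Suc mult_Suc_right)
  qed
  moreover have "total_computable (\<lambda>x. LEAST q. f x < Suc d * Suc q)"
  proof (rule tc_Least)
    show "decidable (\<lambda>w. f (fst (prod_decode w)) < Suc d * Suc (snd (prod_decode w)))"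
      by (intro decidable_less tc_mult tc_const tc_Suc tc_comp[OF f] tc_fst tc_snd tc_id)
    show "\<exists>q. f x < Suc d * Suc q" for x
      by (rule exI[of _ "f x"]) simp
  qed
  ultimately show ?thesis by simp
qed

lemma tc_mod:
  assumes "total_computable f"
  shows "total_computable (\<lambda>x. f x mod Suc d)"
  unfolding minus_mult_div_eq_mod[symmetric] by (intro tc_diff tc_mult tc_const tc_div assms)

text \<open>Bit \<open>n\<close> of \<open>u\<close> is read off from a decomposition of
  \<open>u\<close> with bounded \<open>q\<close> and \<open>r\<close>. This avoids dividing by the
  variable \<open>2 ^ n\<close>, as \<open>tc_div\<close> covers constant divisors only.\<close>

lemma in_set_decode_iff:
  "n \<in> set_decode u \<longleftrightarrow> (\<exists>q<Suc u. \<exists>r<2 ^ n. u = Suc (2 * q) * 2 ^ n + r)"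
proof
  assume "n \<in> set_decode u"
  then have "odd (u div 2 ^ n)" by (simp add: set_decode_def)
  then obtain q where q: "u div 2 ^ n = Suc (2 * q)" by (metis oddE Suc_eq_plus1)
  then have "u = Suc (2 * q) * 2 ^ n + u mod 2 ^ n" by (metis div_mult_mod_eq)
  moreover have "q < Suc u" using q div_le_dividend[of u "2 ^ n"] by linarith
  ultimately show "\<exists>q<Suc u. \<exists>r<2 ^ n. u = Suc (2 * q) * 2 ^ n + r"
    by (meson mod_less_divisor zero_less_power zero_less_numeral)
next
  assume "\<exists>q<Suc u. \<exists>r<2 ^ n. u = Suc (2 * q) * 2 ^ n + r"
  then obtain q r where r: "r < 2 ^ n" and u: "u = Suc (2 * q) * 2 ^ n + r" by blast
  have "u div 2 ^ n = Suc (2 * q)" using r unfolding u by (subst div_mult_self3) auto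
  then show "n \<in> set_decode u" by (simp add: set_decode_def)
qed

lemma decidable_set_decode:
  assumes "total_computable f" "total_computable g"
  shows "decidable (\<lambda>x. f x \<in> set_decode (g x))"
  unfolding in_set_decode_iff
  by (intro decidable_bex decidable_eq tc_Suc tc_add tc_mult tc_power tc_const
      tc_comp[OF assms(1)] tc_comp[OF assms(2)] tc_fst tc_snd tc_id)

lemmas computable_intros =
  decidable_not decidable_conj decidable_disj decidable_imp decidable_le decidable_less
  decidable_eq decidable_bex decidable_ball decidable_set_decode tc_Suc tc_fst tc_snd tc_pair
  tc_const tc_add tc_mult tc_diff tc_div tc_mod tc_id

section \<open>Computably enumerable sets\<close>

lemma partial_computable_iff: "partial_computable f \<longleftrightarrow> (\<exists>p. f = run Map.empty p)"
  unfolding partial_computable_def Phi_def by (metis bij_index bij_inv_eq_iff)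

text \<open>The unbounded search for a witness converges exactly on the projected set.\<close>

lemma comp_enumI:
  assumes "decidable (\<lambda>w. P (fst (prod_decode w)) (snd (prod_decode w)))"
  shows "comp_enum {x. \<exists>n. P x n}"
proof -
  obtain p where
    "\<And>w. run Map.empty p w = Some (of_bool (\<not> P (fst (prod_decode w)) (snd (prod_decode w))))"
    using decidable_not[OF assms] unfolding decidable_def total_computable_def by blast
  then have "run Map.empty p (prod_encode (x, n)) = Some (of_bool (\<not> P x n))" for x n by simp
  from run_Mu_total[OF this] have "{x. \<exists>n. P x n} = dom (run Map.empty (Mu p))"
    by (auto simp: dom_def simp del: run.simps split: if_splits)
  then show ?thesis unfolding comp_enum_def partial_computable_iff by blast
qed

lemma comp_enum_decidable: "decidable P \<Longrightarrow> comp_enum {x. P x}"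
  using comp_enumI[of "\<lambda>x n. P x"] decidable_comp[OF _ tc_fst[OF tc_id]] by simp

section \<open>The halting problem\<close>

definition eval_code :: "nat \<Rightarrow> nat \<Rightarrow> nat \<Rightarrow> nat" where
  "eval_code e x y = prod_encode (e, prod_encode (x, y))"

text \<open>
  \<open>justified D e x y\<close>: the claim that program \<open>e\<close> maps \<open>x\<close> to \<open>y\<close> follows in one step from claims
  coded in \<open>D\<close>. The one-step rules are well-founded, so in a set of claims justified
  by itself every claim is true, and no order of derivation has to be recorded.
\<close>

definition justified_compound :: "nat set \<Rightarrow> nat \<Rightarrow> nat \<Rightarrow> nat \<Rightarrow> nat \<Rightarrow> nat \<Rightarrow> bool" where
  "justified_compound D e r m x y \<longleftrightarrow>
    (let a = fst (prod_decode m); b = snd (prod_decode m);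
      c = fst (prod_decode x); n = snd (prod_decode x) in
      r = 0 \<and> eval_code a x (fst (prod_decode y)) \<in> D \<and> eval_code b x (snd (prod_decode y)) \<in> D \<or>
      r = 1 \<and> (\<exists>z. eval_code b x z \<in> D \<and> eval_code a z y \<in> D) \<or>
      r = 2 \<and> (n = 0 \<and> eval_code a c y \<in> D \<or>
        0 < n \<and> (\<exists>z. eval_code e (prod_encode (c, n - 1)) z \<in> D \<and>
          eval_code b (prod_encode (c, prod_encode (n - 1, z))) y \<in> D)) \<or>
      r = 3 \<and> eval_code m (prod_encode (x, y)) 0 \<in> D \<and>
        (\<forall>k<y. \<exists>z. 0 < z \<and> eval_code m (prod_encode (x, k)) z \<in> D))"

definition justified :: "nat set \<Rightarrow> nat \<Rightarrow> nat \<Rightarrow> nat \<Rightarrow> bool" where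
  "justified D e x y \<longleftrightarrow>
    e = 0 \<and> y = 0 \<or>
    e = 1 \<and> y = Suc x \<or>
    e = 2 \<and> y = fst (prod_decode x) \<or>
    e = 3 \<and> y = snd (prod_decode x) \<or>
    5 \<le> e \<and> justified_compound D e ((e - 5) mod Suc 3) ((e - 5) div Suc 3) x y"

text \<open>From 5 on, an index \<open>e\<close> stores the constructor in the remainder of
  \<open>e - 5\<close> modulo 4 and the subprograms in the quotient.\<close>

lemma justified_iff_compound:
  "justified D (5 + 4 * m) x y \<longleftrightarrow> justified_compound D (5 + 4 * m) 0 m x y"
  "justified D (6 + 4 * m) x y \<longleftrightarrow> justified_compound D (6 + 4 * m) 1 m x y"
  "justified D (7 + 4 * m) x y \<longleftrightarrow> justified_compound D (7 + 4 * m) 2 m x y"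
  "justified D (8 + 4 * m) x y \<longleftrightarrow> justified_compound D (8 + 4 * m) 3 m x y"
proof -
  have sub: "5 + 4 * m - 5 = 0 + 4 * m" "6 + 4 * m - 5 = 1 + 4 * m"
    "7 + 4 * m - 5 = 2 + 4 * m" "8 + 4 * m - 5 = 3 + 4 * m"
    by linarith+
  have dm: "(k + 4 * m) mod Suc 3 = k" "(k + 4 * m) div Suc 3 = m" if "k < 4" for k
    using that by simp_all
  have "0 < (4::nat)" "1 < (4::nat)" "2 < (4::nat)" "3 < (4::nat)" by simp_all
  note dm = this[THEN dm(1)] this[THEN dm(2)]
  show
    "justified D (5 + 4 * m) x y \<longleftrightarrow> justified_compound D (5 + 4 * m) 0 m x y"
    "justified D (6 + 4 * m) x y \<longleftrightarrow> justified_compound D (6 + 4 * m) 1 m x y"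
    "justified D (7 + 4 * m) x y \<longleftrightarrow> justified_compound D (7 + 4 * m) 2 m x y"
    "justified D (8 + 4 * m) x y \<longleftrightarrow> justified_compound D (8 + 4 * m) 3 m x y"
    unfolding justified_def sub dm by simp_all
qed

text \<open>The rules mirror \<open>run\<close> for the empty oracle, so a claim about
  \<open>Query\<close> is never justified.\<close>

lemma justified_simps:
  "justified D (index Zer) x y \<longleftrightarrow> y = 0"
  "justified D (index Succ) x y \<longleftrightarrow> y = Suc x"
  "justified D (index Left) x y \<longleftrightarrow> y = fst (prod_decode x)"
  "justified D (index Right) x y \<longleftrightarrow> y = snd (prod_decode x)"
  "\<not> justified D (index Query) x y"
  "justified D (index (Tup p q)) x y \<longleftrightarrow>
    eval_code (index p) x (fst (prod_decode y)) \<in> D \<and>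
    eval_code (index q) x (snd (prod_decode y)) \<in> D"
  "justified D (index (Comp p q)) x y \<longleftrightarrow>
    (\<exists>z. eval_code (index q) x z \<in> D \<and> eval_code (index p) z y \<in> D)"
  "justified D (index (Rec p q)) (prod_encode (c, 0)) y \<longleftrightarrow> eval_code (index p) c y \<in> D"
  "justified D (index (Rec p q)) (prod_encode (c, Suc n)) y \<longleftrightarrow>
    (\<exists>z. eval_code (index (Rec p q)) (prod_encode (c, n)) z \<in> D \<and>
      eval_code (index q) (prod_encode (c, prod_encode (n, z))) y \<in> D)"
  "justified D (index (Mu p)) x y \<longleftrightarrow>
    eval_code (index p) (prod_encode (x, y)) 0 \<in> D \<and>
    (\<forall>k<y. \<exists>z. 0 < z \<and> eval_code (index p) (prod_encode (x, k)) z \<in> D)"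
  unfolding index.simps justified_iff_compound
  by (simp_all add: justified_def justified_compound_def)

text \<open>The set of claims occurs only positively in the rules.\<close>

lemma justified_mono:
  assumes "justified D e x y" and sub: "D \<subseteq> D'"
  shows "justified D' e x y"
  using assms(1) unfolding justified_def justified_compound_def Let_def
  by (elim disj_forward conj_forward ex_forward all_forward imp_forward)
    (assumption | erule subsetD[OF sub])+

definition self_justified :: "nat set \<Rightarrow> bool" where
  "self_justified D \<longleftrightarrow> (\<forall>e x y. eval_code e x y \<in> D \<longrightarrow> justified D e x y)"

text \<open>This removes \<open>LEAST\<close> and gives minimisation the shape of its rule in
  \<open>justified\<close>.\<close>

lemma run_Mu_eq_Some:
  "run Z (Mu p) x = Some y \<longleftrightarrow>
    run Z p (prod_encode (x, y)) = Some 0 \<and>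
    (\<forall>k<y. \<exists>z. 0 < z \<and> run Z p (prod_encode (x, k)) = Some z)" (is "_ \<longleftrightarrow> ?R")
proof
  let ?f = "\<lambda>n. run Z p (prod_encode (x, n))"
  assume L: "run Z (Mu p) x = Some y"
  then obtain n where n: "?f n = Some 0" "\<forall>m<n. ?f m \<noteq> None"
    and y: "y = (LEAST n. ?f n = Some 0)" by (auto split: if_splits)
  have "y \<le> n" unfolding y using n(1) by (rule Least_le)
  moreover have "?f y = Some 0" unfolding y using n(1) by (rule LeastI)
  moreover have "?f m \<noteq> Some 0" if "m < y" for m using that unfolding y by (rule not_less_Least)
  ultimately show ?R using n(2) by (metis le_trans not_None_eq not_gr_zero not_le)
next
  let ?f = "\<lambda>n. run Z p (prod_encode (x, n))"
  assume R: ?R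
  then have "(LEAST n. ?f n = Some 0) = y"
    by (intro Least_equality) (auto simp: not_less[symmetric])
  moreover have "\<exists>n. ?f n = Some 0 \<and> (\<forall>m<n. ?f m \<noteq> None)" using R by blast
  ultimately show "run Z (Mu p) x = Some y" by simp
qed

text \<open>Justifications refer to proper subprograms, except that \<open>Rec\<close> at a positive
  counter also refers to itself at the preceding one. Hence induction on the program, with an inner
  induction on the counter.\<close>

lemma self_justified_sound:
  assumes D: "self_justified D"
  shows "eval_code (index p) x y \<in> D \<Longrightarrow> run Map.empty p x = Some y"
proof (induction p arbitrary: x y)
  case (Rec p q)
  have "eval_code (index (Rec p q)) (prod_encode (c, n)) y \<in> D \<Longrightarrow>
      run Map.empty (Rec p q) (prod_encode (c, n)) = Some y" for c n y
  proof (induction n arbitrary: y)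
    case 0
    then have "eval_code (index p) c y \<in> D"
      using D unfolding self_justified_def by (metis justified_simps(8))
    then show ?case using Rec.IH(1) by simp
  next
    case (Suc n)
    then obtain z where "eval_code (index (Rec p q)) (prod_encode (c, n)) z \<in> D"
      "eval_code (index q) (prod_encode (c, prod_encode (n, z))) y \<in> D"
      using D unfolding self_justified_def by (metis justified_simps(9))
    then show ?case using Suc.IH Rec.IH(2) by simp
  qed
  then show ?case using Rec.prems by (metis prod_decode_inverse surj_pair)
next
  case (Mu p)
  then have "justified D (index (Mu p)) x y" using D unfolding self_justified_def by blast
  then show ?case unfolding run_Mu_eq_Some justified_simps using Mu.IH by blast
next
  case (Comp p q)
  then have "justified D (index (Comp p q)) x y" using D unfolding self_justified_def by blast
  then obtain z where "eval_code (index q) x z \<in> D" "eval_code (index p) z y \<in> D"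
    unfolding justified_simps by blast
  then show ?case using Comp.IH by simp
next
  case (Tup p q)
  then have "justified D (index (Tup p q)) x y" using D unfolding self_justified_def by blast
  then have "run Map.empty p x = Some (fst (prod_decode y))"
    "run Map.empty q x = Some (snd (prod_decode y))"
    unfolding justified_simps using Tup.IH by blast+
  then show ?case by simp
qed (use D[unfolded self_justified_def] justified_simps(1-5) in \<open>simp, metis\<close>)+

section \<open>Finite derivations of convergent computations\<close>

lemma eval_code_inject [simp]:
  "eval_code e x y = eval_code e' x' y' \<longleftrightarrow> e = e' \<and> x = x' \<and> y = y'"
  by (simp add: eval_code_def)

text \<open>Finiteness gives every derivation a canonical code, so that derivations can be searched
  for.\<close>

definition derivable :: "nat \<Rightarrow> nat \<Rightarrow> nat \<Rightarrow> bool" where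
  "derivable e x y \<longleftrightarrow> (\<exists>D. finite D \<and> self_justified D \<and> eval_code e x y \<in> D)"

lemma self_justified_Union: "(\<And>D. D \<in> A \<Longrightarrow> self_justified D) \<Longrightarrow> self_justified (\<Union> A)"
  unfolding self_justified_def by (meson Union_iff Union_upper justified_mono)

text \<open>The derivations of the finitely many premises are united and the new claim is added;
  monotonicity keeps the result self-justified.\<close>

lemma derivable_step:
  assumes "finite S" "justified S e x y"
    and S: "\<And>t. t \<in> S \<Longrightarrow> \<exists>e x y. t = eval_code e x y \<and> derivable e x y"
  shows "derivable e x y"
proof -
  have "\<forall>t\<in>S. \<exists>D. finite D \<and> self_justified D \<and> t \<in> D"
    using S unfolding derivable_def by blast
  then obtain G where G: "\<And>t. t \<in> S \<Longrightarrow> finite (G t) \<and> self_justified (G t) \<and> t \<in> G t"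
    by metis
  define D where "D = \<Union> (G ` S)"
  have D: "finite D" "self_justified D" "S \<subseteq> D"
    unfolding D_def using assms(1) G by (auto intro: self_justified_Union)
  then have "self_justified (insert (eval_code e x y) D)"
    using assms(2) unfolding self_justified_def
    by (metis eval_code_inject insert_iff justified_mono subset_insertI subset_trans)
  then show ?thesis unfolding derivable_def using D(1) by (metis finite_insert insertI1)
qed

text \<open>The converse of soundness: in each case the premises are the claims about the
  subcomputations that were actually performed.\<close>

lemma run_derivable: "run Map.empty p x = Some y \<Longrightarrow> derivable (index p) x y"
proof (induction p arbitrary: x y)
  case (Tup p q)
  then obtain a b where "run Map.empty p x = Some a" "run Map.empty q x = Some b"
    and y: "y = prod_encode (a, b)" by (auto simp: bind_eq_Some_conv)
  then show ?case
    by (intro derivable_step[of "{eval_code (index p) x a, eval_code (index q) x b}"])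
      (auto simp only: justified_simps y finite.intros insert_iff prod_encode_inverse fst_conv
        snd_conv empty_iff intro: Tup.IH)
next
  case (Comp p q)
  then obtain z where "run Map.empty q x = Some z" "run Map.empty p z = Some y"
    by (auto simp: bind_eq_Some_conv)
  then show ?case
    by (intro derivable_step[of "{eval_code (index q) x z, eval_code (index p) z y}"])
      (auto simp only: justified_simps finite.intros insert_iff empty_iff intro: Comp.IH)
next
  case (Rec p q)
  have "run Map.empty (Rec p q) (prod_encode (c, n)) = Some y \<Longrightarrow>
      derivable (index (Rec p q)) (prod_encode (c, n)) y" for c n y
  proof (induction n arbitrary: y)
    case 0
    then have "run Map.empty p c = Some y" by simp
    then show ?case
      by (intro derivable_step[of "{eval_code (index p) c y}"])
        (auto simp only: justified_simps finite.intros insert_iff empty_iff intro: Rec.IH)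
  next
    case (Suc n)
    then obtain z where "run Map.empty (Rec p q) (prod_encode (c, n)) = Some z"
      "run Map.empty q (prod_encode (c, prod_encode (n, z))) = Some y"
      by (auto simp: bind_eq_Some_conv)
    then show ?case
      by (intro derivable_step[of "{eval_code (index (Rec p q)) (prod_encode (c, n)) z,
            eval_code (index q) (prod_encode (c, prod_encode (n, z))) y}"])
        (auto simp only: justified_simps finite.intros insert_iff empty_iff intro: Rec.IH Suc.IH)
  qed
  then show ?case using Rec.prems by (metis prod_decode_inverse surj_pair)
next
  case (Mu p)
  then have r: "run Map.empty p (prod_encode (x, y)) = Some 0"
    "\<forall>k<y. \<exists>z. 0 < z \<and> run Map.empty p (prod_encode (x, k)) = Some z"
    unfolding run_Mu_eq_Some by auto
  then obtain g where
    g: "\<And>k. k < y \<Longrightarrow> 0 < g k \<and> run Map.empty p (prod_encode (x, k)) = Some (g k)" by metis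
  show ?case
  proof (rule derivable_step)
    \<comment> \<open>Besides the final zero, the positive values \<open>g k\<close> found before it
      belong to the record of the search.\<close>
    let ?S = "insert (eval_code (index p) (prod_encode (x, y)) 0)
      ((\<lambda>k. eval_code (index p) (prod_encode (x, k)) (g k)) ` {..<y})"
    show "finite ?S" by simp
    show "justified ?S (index (Mu p)) x y" unfolding justified_simps using g by blast
    show "\<exists>e x y. t = eval_code e x y \<and> derivable e x y" if "t \<in> ?S" for t
      using that r(1) g Mu.IH by blast
  qed
qed (rule derivable_step[of "{}"]; force simp only: justified_simps run.simps option.inject)+

section \<open>Bounds that make checking a derivation decidable\<close>

lemma set_decode_less: "n \<in> set_decode u \<Longrightarrow> n < u"
proof -
  assume "n \<in> set_decode u"
  then have "u div 2 ^ n \<noteq> 0" unfolding set_decode_def by (metis even_zero mem_Collect_eq)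
  then have "2 ^ n \<le> u" by (simp add: div_eq_0_iff not_less)
  then show "n < u" using less_exp[of n] by linarith
qed

lemma eval_code_less:
  assumes "eval_code e x y \<in> set_decode u"
  shows "e < u" "x < u" "y < u"
  using set_decode_less[OF assms] le_prod_encode_1[of e "prod_encode (x, y)"]
    le_prod_encode_2[of "prod_encode (x, y)" e] le_prod_encode_1[of x y] le_prod_encode_2[of y x]
  unfolding eval_code_def by linarith+

text \<open>Every intermediate value \<open>z\<close> occurs in a claim coded in \<open>u\<close>
  and is therefore below \<open>u\<close>.\<close>

lemma justified_compound_bounded:
  "justified_compound (set_decode u) e r m x y \<longleftrightarrow>
    (let a = fst (prod_decode m); b = snd (prod_decode m);
      c = fst (prod_decode x); n = snd (prod_decode x) in
      r = 0 \<and> eval_code a x (fst (prod_decode y)) \<in> set_decode u \<and>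
        eval_code b x (snd (prod_decode y)) \<in> set_decode u \<or>
      r = 1 \<and> (\<exists>z<u. eval_code b x z \<in> set_decode u \<and> eval_code a z y \<in> set_decode u) \<or>
      r = 2 \<and> (n = 0 \<and> eval_code a c y \<in> set_decode u \<or>
        0 < n \<and> (\<exists>z<u. eval_code e (prod_encode (c, n - 1)) z \<in> set_decode u \<and>
          eval_code b (prod_encode (c, prod_encode (n - 1, z))) y \<in> set_decode u)) \<or>
      r = 3 \<and> eval_code m (prod_encode (x, y)) 0 \<in> set_decode u \<and>
        (\<forall>k<y. \<exists>z<u. 0 < z \<and> eval_code m (prod_encode (x, k)) z \<in> set_decode u))"
proof -
  have bex: "(\<exists>z. eval_code e' x' z \<in> set_decode u \<and> Q z) \<longleftrightarrow>
      (\<exists>z<u. eval_code e' x' z \<in> set_decode u \<and> Q z)" for e' x' Q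
    using eval_code_less(3) by blast
  have "(\<exists>z. 0 < z \<and> eval_code e' x' z \<in> set_decode u) \<longleftrightarrow>
      (\<exists>z<u. 0 < z \<and> eval_code e' x' z \<in> set_decode u)" for e' x'
    using eval_code_less(3) by blast
  then show ?thesis
    unfolding justified_compound_def by (subst (1 2) bex) (simp only:)
qed

lemma self_justified_bounded:
  "self_justified (set_decode u) \<longleftrightarrow>
    (\<forall>e<u. \<forall>x<u. \<forall>y<u. eval_code e x y \<in> set_decode u \<longrightarrow> justified (set_decode u) e x y)"
  unfolding self_justified_def using eval_code_less by blast

text \<open>This plays the role of Kleene's T predicate, with \<open>u\<close> as the code of the
  computation record.\<close>

definition halts_witness :: "nat \<Rightarrow> nat \<Rightarrow> nat \<Rightarrow> nat \<Rightarrow> bool" where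
  "halts_witness u e x y \<longleftrightarrow> self_justified (set_decode u) \<and> eval_code e x y \<in> set_decode u"

text \<open>A normal form theorem: soundness gives one direction, and the other takes the canonical
  code of a finite derivation.\<close>

lemma Phi_eq_Some_iff: "Phi e Map.empty x = Some y \<longleftrightarrow> (\<exists>u. halts_witness u e x y)"
proof -
  obtain p where e: "e = index p" using surj_index by (metis surjD)
  have "Phi e = (\<lambda>Z. run Z p)" unfolding Phi_def e by (simp add: inj_index)
  moreover have "derivable e x y \<longleftrightarrow> (\<exists>u. halts_witness u e x y)"
    unfolding derivable_def halts_witness_def by (metis finite_set_decode set_encode_inverse)
  ultimately show ?thesis
    using run_derivable self_justified_sound unfolding e derivable_def by metis
qed

lemma decidable_halts_witness:
  assumes "total_computable u" "total_computable e" "total_computable x" "total_computable y"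
  shows "decidable (\<lambda>w. halts_witness (u w) (e w) (x w) (y w))"
proof -
  have "decidable (\<lambda>w. self_justified (set_decode w))"
    unfolding self_justified_bounded justified_def justified_compound_bounded Let_def eval_code_def
    by (intro computable_intros)
  from decidable_comp[OF this assms(1)] show ?thesis
    unfolding halts_witness_def eval_code_def by (intro computable_intros assms)
qed

definition halting :: "nat set" where
  "halting = {n. Phi n Map.empty n \<noteq> None}"

lemma halting_iff:
  "n \<in> halting \<longleftrightarrow> (\<exists>w. halts_witness (fst (prod_decode w)) n n (snd (prod_decode w)))"
  unfolding halting_def mem_Collect_eq not_None_eq Phi_eq_Some_iff
  by (metis fst_conv prod_encode_inverse snd_conv)

text \<open>Diagonalisation: an index \<open>e\<close> of the complement would belong to it exactly
  if it belongs to \<open>halting\<close>.\<close>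

lemma not_comp_enum_compl_halting: "\<not> comp_enum (- halting)"
proof
  assume "comp_enum (- halting)"
  then obtain e where "- halting = dom (Phi e Map.empty)"
    unfolding comp_enum_def partial_computable_def by blast
  then show False unfolding halting_def by blast
qed

section \<open>Application is computable on indices\<close>

primrec subst_query :: "prog \<Rightarrow> prog \<Rightarrow> prog" where
  "subst_query r Zer = Zer"
| "subst_query r Succ = Succ"
| "subst_query r Left = Left"
| "subst_query r Right = Right"
| "subst_query r Query = r"
| "subst_query r (Tup p q) = Tup (subst_query r p) (subst_query r q)"
| "subst_query r (Comp p q) = Comp (subst_query r p) (subst_query r q)"
| "subst_query r (Rec p q) = Rec (subst_query r p) (subst_query r q)"
| "subst_query r (Mu p) = Mu (subst_query r p)"

text \<open>An oracle computed by a program can be compiled into the computation that queries it;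
  strictness makes this correct for partial oracles too.\<close>

lemma run_subst_query: "run Z (subst_query r p) = run (run Z r) p"
  by (induction p) (simp_all only: subst_query.simps run.simps)

text \<open>As \<open>p\<close> is fixed, the index arises from that of \<open>r d\<close> by
  finitely many pairings and arithmetic operations.\<close>

lemma tc_index_subst_query:
  assumes "total_computable (\<lambda>d. index (r d))"
  shows "total_computable (\<lambda>d. index (subst_query (r d) p))"
  by (induction p) (simp_all only: subst_query.simps index.simps, (intro computable_intros assms | assumption)+)

text \<open>
  \<open>Rec Zer\<close> runs its step exactly when the second argument is 1, which gives a lazy conditional: the
  branch that is not taken contributes 0 and may be undefined.
\<close>

lemma ex_join_prog:
  "\<exists>J. (\<forall>q. run Map.empty (J q) = run Map.empty p \<oplus> run Map.empty q) \<and>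
    total_computable (\<lambda>d. index (J (inv index d)))"
proof -
  have tc: "total_computable (\<lambda>w. fst (prod_decode w) + snd (prod_decode w))"
    "total_computable (\<lambda>n. prod_encode (n div Suc 1, 1 - n mod Suc 1))"
    "total_computable (\<lambda>n. prod_encode (n div Suc 1, n mod Suc 1))"
    by (intro computable_intros)+
  obtain add where
    add: "\<And>w. run Map.empty add w = Some (fst (prod_decode w) + snd (prod_decode w))"
    using tc(1) unfolding total_computable_def by blast
  obtain ev where ev: "\<And>n. run Map.empty ev n = Some (prod_encode (n div 2, 1 - n mod 2))"
    using tc(2) unfolding total_computable_def by (auto simp: numeral_2_eq_2)
  obtain od where od: "\<And>n. run Map.empty od n = Some (prod_encode (n div 2, n mod 2))"
    using tc(3) unfolding total_computable_def by (auto simp: numeral_2_eq_2)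
  define J where "J q = Comp add (Tup (Comp (Rec Zer (Comp p Left)) ev)
      (Comp (Rec Zer (Comp q Left)) od))" for q
  have "run Map.empty (J q) n = (run Map.empty p \<oplus> run Map.empty q) n" for q n
    by (cases "even n") (auto simp: J_def add ev od join_def odd_iff_mod_2_eq_one even_iff_mod_2_eq_zero
        bind_assoc split: bind_split)
  moreover have "total_computable (\<lambda>d. index (J (inv index d)))"
    unfolding J_def index.simps surj_f_inv_f[OF surj_index] by (intro computable_intros)
  ultimately show ?thesis by blast
qed

text \<open>The functional is selected by \<open>f 0\<close> and hence fixed; only the right half of
  its oracle varies with \<open>d\<close>.\<close>

lemma B_app_index:
  assumes "partial_computable f"
  obtains s where "total_computable s" "\<And>d. Phi (s d) Map.empty = B_app f (Phi d Map.empty)"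
proof -
  have Phi_index: "Phi (index p) Z = run Z p" for p Z
    unfolding Phi_def by (simp add: inj_index)
  obtain p where f: "f = run Map.empty p" using assms unfolding partial_computable_iff by blast
  obtain J where J: "\<And>q. run Map.empty (J q) = f \<oplus> run Map.empty q"
    "total_computable (\<lambda>d. index (J (inv index d)))"
    using ex_join_prog unfolding f by metis
  show ?thesis
  proof (cases "f 0")
    case None
    \<comment> \<open>Without \<open>f 0\<close> the application is nowhere defined, as is a query
      to the empty oracle.\<close>
    then have "Phi (index Query) Map.empty = B_app f (Phi d Map.empty)" for d
      unfolding Phi_index B_app_def by simp
    with tc_const show ?thesis by (rule that)
  next
    case (Some e)
    have "Phi (index (subst_query (J (inv index d)) (inv index e))) Map.empty =
        B_app f (Phi d Map.empty)" for d
      unfolding Phi_index run_subst_query J(1) B_app_def Some by (simp add: Phi_def)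
    with tc_index_subst_query[OF J(2)] show ?thesis by (rule that)
  qed
qed

section \<open>Sequentiality\<close>

text \<open>A convergent computation receives the same answers from any larger oracle.\<close>

lemma run_mono: "Z \<subseteq>\<^sub>m Z' \<Longrightarrow> run Z p x = Some y \<Longrightarrow> run Z' p x = Some y"
proof (induction p arbitrary: x y)
  case Query
  then show ?case by (auto simp: map_le_def dom_def)
next
  case (Tup p q)
  then show ?case by (auto simp: bind_eq_Some_conv)
next
  case (Comp p q)
  then show ?case by (auto simp: bind_eq_Some_conv)
next
  case (Rec p q)
  have "run Z (Rec p q) (prod_encode (c, n)) = Some y \<Longrightarrow>
      run Z' (Rec p q) (prod_encode (c, n)) = Some y" for c n y
    by (induction n arbitrary: y) (use Rec.IH Rec.prems(1) in \<open>auto simp: bind_eq_Some_conv\<close>)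
  then show ?case using Rec.prems(2) by (metis prod_decode_inverse surj_pair)
next
  case (Mu p)
  then show ?case unfolding run_Mu_eq_Some by blast
qed simp_all

text \<open>
  A divergent computation either diverges for every larger oracle (\<open>Q = {}\<close>), or it is stuck at a
  single query (\<open>Q = {q}\<close>).
\<close>

definition stuck_on :: "(nat \<rightharpoonup> nat) \<Rightarrow> prog \<Rightarrow> nat \<Rightarrow> nat set \<Rightarrow> bool" where
  "stuck_on Z p x Q \<longleftrightarrow> (\<forall>q\<in>Q. Z q = None) \<and> (\<forall>q\<in>Q. Q = {q}) \<and>
    (\<forall>Z'. Z \<subseteq>\<^sub>m Z' \<longrightarrow> (\<forall>q\<in>Q. Z' q = None) \<longrightarrow> run Z' p x = None)"

lemma stuck_on_transfer:
  assumes "stuck_on Z p x Q"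
    and "\<And>Z'. Z \<subseteq>\<^sub>m Z' \<Longrightarrow> run Z' p x = None \<Longrightarrow> run Z' p' x' = None"
  shows "stuck_on Z p' x' Q"
  using assms unfolding stuck_on_def by blast

text \<open>Evaluation has a fixed order, so the first divergent subcomputation blocks the whole.
  Those before it keep their values under larger oracles by \<open>run_mono\<close>.\<close>

lemma run_None_stuck: "run Z p x = None \<Longrightarrow> \<exists>Q. stuck_on Z p x Q"
proof (induction p arbitrary: x)
  case Query
  then have "stuck_on Z Query x {x}" unfolding stuck_on_def by simp
  then show ?case by blast
next
  case (Tup p q)
  show ?case
  proof (cases "run Z p x")
    case None
    then obtain Q where "stuck_on Z p x Q" using Tup.IH(1) by blast
    then have "stuck_on Z (Tup p q) x Q" by (rule stuck_on_transfer) simp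
    then show ?thesis by blast
  next
    case (Some y)
    then have "run Z q x = None" using Tup.prems by (cases "run Z q x") auto
    then obtain Q where "stuck_on Z q x Q" using Tup.IH(2) by blast
    then have "stuck_on Z (Tup p q) x Q"
      by (rule stuck_on_transfer) (use run_mono[OF _ Some] in simp)
    then show ?thesis by blast
  qed
next
  case (Comp p q)
  show ?case
  proof (cases "run Z q x")
    case None
    then obtain Q where "stuck_on Z q x Q" using Comp.IH(2) by blast
    then have "stuck_on Z (Comp p q) x Q" by (rule stuck_on_transfer) simp
    then show ?thesis by blast
  next
    case (Some y)
    then obtain Q where "stuck_on Z p y Q" using Comp by auto
    then have "stuck_on Z (Comp p q) x Q"
      by (rule stuck_on_transfer) (use run_mono[OF _ Some] in simp)
    then show ?thesis by blast
  qed
next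
  case (Rec p q)
  have "run Z (Rec p q) (prod_encode (c, n)) = None \<Longrightarrow>
      \<exists>Q. stuck_on Z (Rec p q) (prod_encode (c, n)) Q" for c n
  proof (induction n)
    case 0
    then have "run Z p c = None" by simp
    then obtain Q where "stuck_on Z p c Q" using Rec.IH(1) by blast
    then have "stuck_on Z (Rec p q) (prod_encode (c, 0)) Q"
      by (rule stuck_on_transfer) simp
    then show ?case by blast
  next
    case (Suc n)
    show ?case
    proof (cases "run Z (Rec p q) (prod_encode (c, n))")
      case None
      then obtain Q where "stuck_on Z (Rec p q) (prod_encode (c, n)) Q" using Suc.IH by blast
      then have "stuck_on Z (Rec p q) (prod_encode (c, Suc n)) Q"
        by (rule stuck_on_transfer) simp
      then show ?thesis by blast
    next
      case (Some y)
      then have "run Z q (prod_encode (c, prod_encode (n, y))) = None" using Suc.prems by simp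
      then obtain Q where "stuck_on Z q (prod_encode (c, prod_encode (n, y))) Q"
        using Rec.IH(2) by blast
      then have "stuck_on Z (Rec p q) (prod_encode (c, Suc n)) Q"
        by (rule stuck_on_transfer) (use run_mono[OF _ Some] in simp)
      then show ?thesis by blast
    qed
  qed
  then show ?case using Rec.prems by (metis prod_decode_inverse surj_pair)
next
  case (Mu p)
  let ?f = "\<lambda>Z n. run Z p (prod_encode (x, n))"
  show ?case
  proof (cases "\<exists>n. ?f Z n = None \<or> ?f Z n = Some 0")
    case True
    \<comment> \<open>The first stage of the search without a positive value. It cannot be a zero,
      since then the search would succeed, so it diverges and is the blocking one.\<close>
    define n where "n = (LEAST n. ?f Z n = None \<or> ?f Z n = Some 0)"
    have n: "?f Z n = None \<or> ?f Z n = Some 0" unfolding n_def using True by (rule LeastI_ex)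
    have before: "\<exists>z. 0 < z \<and> ?f Z k = Some z" if "k < n" for k
      using not_less_Least[OF that[unfolded n_def]] by (cases "?f Z k") auto
    have "?f Z n \<noteq> Some 0"
      using Mu.prems before run_Mu_eq_Some[of Z p x n] by force
    then obtain Q where "stuck_on Z p (prod_encode (x, n)) Q" using n Mu.IH by blast
    then have "stuck_on Z (Mu p) x Q"
    proof (rule stuck_on_transfer)
      fix Z' assume Z': "Z \<subseteq>\<^sub>m Z'" and None: "?f Z' n = None"
      have "run Z' (Mu p) x \<noteq> Some y" for y
      proof
        assume "run Z' (Mu p) x = Some y"
        then have y: "?f Z' y = Some 0" "\<forall>k<y. ?f Z' k \<noteq> None"
          unfolding run_Mu_eq_Some by auto
        have "\<not> y < n" using before[of y] run_mono[OF Z'] y(1) by force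
        then show False using y None by (metis linorder_neqE_nat option.distinct(1))
      qed
      then show "run Z' (Mu p) x = None" by (metis not_None_eq)
    qed
    then show ?thesis by blast
  next
    case False
    \<comment> \<open>All tested values are defined and positive, and they stay so for larger
      oracles: no query is to blame.\<close>
    have "run Z' (Mu p) x \<noteq> Some y" if "Z \<subseteq>\<^sub>m Z'" for Z' y
      unfolding run_Mu_eq_Some using False run_mono[OF that] by (metis not_None_eq option.inject)
    then have "stuck_on Z (Mu p) x {}" unfolding stuck_on_def by (metis empty_iff not_None_eq)
    then show ?thesis by blast
  qed
qed simp_all

section \<open>Monotonicity and sequentiality of application\<close>

lemma join_mono: "f \<subseteq>\<^sub>m f' \<Longrightarrow> g \<subseteq>\<^sub>m g' \<Longrightarrow> f \<oplus> g \<subseteq>\<^sub>m f' \<oplus> g'"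
  by (auto simp: map_le_def join_def dom_def)

lemma B_app_mono:
  assumes "g \<subseteq>\<^sub>m g'"
  shows "B_app f g \<subseteq>\<^sub>m B_app f g'"
proof -
  have "f \<oplus> g \<subseteq>\<^sub>m f \<oplus> g'" using assms by (intro join_mono) simp_all
  from run_mono[OF this] show ?thesis
    unfolding map_le_def by (force simp: B_app_def Phi_def bind_eq_Some_conv dom_def)
qed

text \<open>Enlarging the left half of the oracle makes the stuck computation converge, so the
  blocking query is even. Enlarging only the right half then leaves it unanswered, contradicting
  \<open>zt\<close>.\<close>

lemma B_app_no_parallel_or:
  assumes le: "z \<subseteq>\<^sub>m t"
    and div: "B_app (B_app u z) z n = None"
    and tz: "B_app (B_app u t) z n \<noteq> None"
    and zt: "B_app (B_app u z) t n \<noteq> None"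
  shows False
proof -
  let ?a = "B_app u z" and ?b = "B_app u t"
  have ab: "?a \<subseteq>\<^sub>m ?b" using le by (rule B_app_mono)
  \<comment> \<open>The value at 0 selects the functional, so all three computations run the same
    program.\<close>
  obtain e where a0: "?a 0 = Some e" using zt unfolding B_app_def[of ?a] by fastforce
  then have b0: "?b 0 = Some e" using ab by (metis domI map_le_def)
  let ?p = "inv index e"
  have "run (?a \<oplus> z) ?p n = None" using div a0 by (simp add: B_app_def[of ?a] Phi_def)
  then obtain Q where "stuck_on (?a \<oplus> z) ?p n Q" using run_None_stuck by blast
  then have Q: "\<And>q. q \<in> Q \<Longrightarrow> (?a \<oplus> z) q = None" "\<And>q. q \<in> Q \<Longrightarrow> Q = {q}"
    and stuck: "\<And>Z'. ?a \<oplus> z \<subseteq>\<^sub>m Z' \<Longrightarrow> \<forall>q\<in>Q. Z' q = None \<Longrightarrow> run Z' ?p n = None"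
    unfolding stuck_on_def by simp_all
  have "run (?b \<oplus> z) ?p n \<noteq> None" using tz b0 by (simp add: B_app_def[of ?b] Phi_def)
  moreover have "?a \<oplus> z \<subseteq>\<^sub>m ?b \<oplus> z" using ab by (intro join_mono) simp_all
  ultimately obtain q where q: "q \<in> Q" "(?b \<oplus> z) q \<noteq> None" using stuck by metis
  note Q = Q[OF q(1)]
  \<comment> \<open>Odd queries go to \<open>z\<close> in both oracles and cannot become
    answered.\<close>
  have "even q" using q(2) Q(1) by (auto simp: join_def split: if_splits)
  then have "(?a \<oplus> t) q = None" using Q(1) by (simp add: join_def)
  moreover have "?a \<oplus> z \<subseteq>\<^sub>m ?a \<oplus> t" using le by (intro join_mono) simp_all
  ultimately have "run (?a \<oplus> t) ?p n = None"
    using stuck Q(2) by simp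
  then show False using zt a0 by (simp add: B_app_def[of ?a] Phi_def)
qed

section \<open>Elements of the graph model\<close>

text \<open>A graph of the operator adding 1 to every element. Admitting every finite set containing
  the element, not only the singleton, lets a bit test decide membership.\<close>

definition graph_succ :: "nat set" where
  "graph_succ = {w. 0 < fst (prod_decode w) \<and> fst (prod_decode w) - 1 \<in> set_decode (snd (prod_decode w))}"

text \<open>A graph of the operator that yields \<open>{0}\<close> on sets meeting
  \<open>halting\<close> and \<open>{}\<close> on all others.\<close>

definition graph_halting :: "nat set" where
  "graph_halting = {w. fst (prod_decode w) = 0 \<and> (\<exists>k\<in>halting. k \<in> set_decode (snd (prod_decode w)))}"

text \<open>The curried binary union: for an element coding ((m, v), u), \<open>u\<close>
  approximates the first argument and \<open>v\<close> the second.\<close>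

definition graph_union :: "nat set" where
  "graph_union = {w. fst (prod_decode (fst (prod_decode w))) \<in> set_decode (snd (prod_decode w)) \<or>
    fst (prod_decode (fst (prod_decode w))) \<in> set_decode (snd (prod_decode (fst (prod_decode w))))}"

lemma singleton_subset_code: "n \<in> X \<Longrightarrow> \<exists>u. n \<in> set_decode u \<and> set_decode u \<subseteq> X"
  using set_encode_inverse[of "{n}"] by (intro exI[of _ "set_encode {n}"]) auto

lemma graph_succ_app: "graph_app graph_succ {n} = {Suc n}"
  unfolding graph_app_def graph_succ_def
  using singleton_subset_code[of n "{n}"] by (auto simp: gr0_conv_Suc)

lemma graph_halting_app: "graph_app graph_halting {n} = (if n \<in> halting then {0} else {})"
  unfolding graph_app_def graph_halting_def
  using singleton_subset_code[of n "{n}"] by auto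

lemma graph_union_app:
  "graph_app graph_union X = {w. fst (prod_decode w) \<in> X \<or>
    fst (prod_decode w) \<in> set_decode (snd (prod_decode w))}"
proof -
  \<comment> \<open>The code 0 of the empty set serves when the second argument already supplies the
    element.\<close>
  have "\<exists>u. set_decode u \<subseteq> X" by (rule exI[of _ 0]) simp
  then show ?thesis
    unfolding graph_app_def graph_union_def using singleton_subset_code[of _ X] by fastforce
qed

lemma graph_union_app_app: "graph_app (graph_app graph_union X) Y = X \<union> Y"
proof -
  have "\<exists>u. set_decode u \<subseteq> Y" by (rule exI[of _ 0]) simp
  then show ?thesis
    unfolding graph_union_app unfolding graph_app_def
    using singleton_subset_code[of _ Y] by fastforce
qed

lemma comp_enum_graph_halting: "comp_enum graph_halting"
proof -
  \<comment> \<open>One \<open>v\<close> codes the element \<open>k\<close>, a halting witness and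
    the output, merging three existential quantifiers.\<close>
  have "graph_halting = {w. \<exists>v. fst (prod_decode w) = 0 \<and>
      fst (prod_decode v) \<in> set_decode (snd (prod_decode w)) \<and>
      halts_witness (fst (prod_decode (snd (prod_decode v)))) (fst (prod_decode v))
        (fst (prod_decode v)) (snd (prod_decode (snd (prod_decode v))))}"
    unfolding graph_halting_def Bex_def halting_iff
    by (auto, metis fst_conv prod_encode_inverse snd_conv)
  also have "comp_enum \<dots>"
    by (rule comp_enumI) (intro computable_intros decidable_halts_witness)
  finally show ?thesis .
qed

section \<open>Consequences of a weak embedding\<close>

text \<open>\<open>F\<close> itself need not be computable: one index of \<open>F {0}\<close>
  suffices, since applying \<open>F graph_succ\<close> acts computably on indices and can be
  iterated.\<close>

lemma singletons_uniformly_computable: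
  assumes F: "\<And>X. comp_enum X \<Longrightarrow> partial_computable (F X)"
    and hom: "\<And>X Y. comp_enum X \<Longrightarrow> comp_enum Y \<Longrightarrow> B_app (F X) (F Y) = F (graph_app X Y)"
  obtains d where "total_computable d" "\<And>n. Phi (d n) Map.empty = F {n}"
proof -
  have sing: "comp_enum {n}" for n
    using comp_enum_decidable[OF decidable_eq[OF tc_id tc_const[of n]]] by simp
  have succ: "comp_enum graph_succ"
    unfolding graph_succ_def by (intro comp_enum_decidable computable_intros)
  obtain s where s: "total_computable s"
    "\<And>d. Phi (s d) Map.empty = B_app (F graph_succ) (Phi d Map.empty)"
    using B_app_index[OF F[OF succ]] by blast
  obtain d0 where d0: "F {0} = Phi d0 Map.empty"
    using F[OF sing] unfolding partial_computable_def by blast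
  define d where "d n = rec_nat d0 (\<lambda>k r. s r) n" for n
  have "total_computable d"
    unfolding d_def by (intro tc_rec_nat tc_const tc_id tc_comp[OF s(1)] tc_snd)
  moreover have "Phi (d n) Map.empty = F {n}" for n
    by (induction n) (simp_all add: d_def d0 s(2) hom[OF succ sing] graph_succ_app)
  ultimately show ?thesis by (rule that)
qed

theorem theorem3p1: "\<not> (\<exists>F. weak_embedding E_pca B_eff_pca F)"
proof
  assume "\<exists>F. weak_embedding E_pca B_eff_pca F"
  then obtain F where F: "\<And>X. comp_enum X \<Longrightarrow> partial_computable (F X)"
    and inj: "inj_on F {X. comp_enum X}"
    and hom: "\<And>X Y. comp_enum X \<Longrightarrow> comp_enum Y \<Longrightarrow> B_app (F X) (F Y) = F (graph_app X Y)"
    unfolding weak_embedding_def E_pca_def B_eff_pca_def by auto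
  have sing: "comp_enum {n}" for n
    using comp_enum_decidable[OF decidable_eq[OF tc_id tc_const[of n]]] by simp
  have empty: "comp_enum {}"
    using comp_enum_decidable[OF decidable_less[OF tc_id tc_const[of 0]]] by simp
  obtain d where d: "total_computable d" "\<And>n. Phi (d n) Map.empty = F {n}"
    using singletons_uniformly_computable[OF F hom] by blast
  obtain s where s: "total_computable s"
    "\<And>d. Phi (s d) Map.empty = B_app (F graph_halting) (Phi d Map.empty)"
    using B_app_index[OF F[OF comp_enum_graph_halting]] by blast
  have sd: "Phi (s (d n)) Map.empty = F (if n \<in> halting then {0} else {})" for n
    unfolding s(2) d(2) hom[OF comp_enum_graph_halting sing] graph_halting_app ..

  have le: "F {} \<subseteq>\<^sub>m F {0}"
  proof (rule ccontr)
    assume "\<not> F {} \<subseteq>\<^sub>m F {0}"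
    then obtain m c where "F {} m = Some c" "F {0} m \<noteq> Some c"
      unfolding map_le_def by force
    \<comment> \<open>For \<open>n\<close> in \<open>halting\<close> the program
      \<open>s (d n)\<close> computes \<open>F {0}\<close> and never gives \<open>c\<close> at
      \<open>m\<close>; otherwise it computes \<open>F {}\<close> and does.\<close>
    then have "- halting = {n. \<exists>u. halts_witness u (s (d n)) m c}"
      unfolding Phi_eq_Some_iff[symmetric] sd by (auto split: if_splits)
    also have "comp_enum \<dots>"
      by (intro comp_enumI decidable_halts_witness tc_comp[OF s(1)] tc_comp[OF d(1)] tc_const
          tc_fst tc_snd tc_id)
    finally show False using not_comp_enum_compl_halting by blast
  qed

  have "F {} \<noteq> F {0}" using inj empty sing by (metis inj_onD insert_not_empty mem_Collect_eq)
  then obtain n where n: "F {} n = None" "F {0} n \<noteq> None"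
    using le by (metis (no_types, lifting) domIff ext map_le_def)
  have U: "comp_enum graph_union"
    unfolding graph_union_def by (intro comp_enum_decidable computable_intros)
  have "decidable (\<lambda>w. w = 0)" "decidable (\<lambda>w. w < 0)" by (intro computable_intros)+
  then have UX: "comp_enum (graph_app graph_union {0})" "comp_enum (graph_app graph_union {})"
    unfolding graph_union_app by (auto intro!: comp_enum_decidable computable_intros)
  \<comment> \<open>Among the four cases only two empty arguments give \<open>F {}\<close>, which is
    undefined at \<open>n\<close>; the others give \<open>F {0}\<close>.\<close>
  have "B_app (B_app (F graph_union) (F X)) (F Y) = F (X \<union> Y)"
    if "X = {} \<or> X = {0}" "Y = {} \<or> Y = {0}" for X Y
    using that hom U UX empty sing by (auto simp: graph_union_app_app)
  then show False
    using B_app_no_parallel_or[OF le, of "F graph_union" n] n by simp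
qed

end
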